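(* Let $Y\subseteq\mathbb{A}^r$. Then the vanishing ideal in $S$ of the subset $[Y\setminus V(B)]$ of $\mathbb{A}^r_G\setminus V_G(B)$ is given by $$I([Y\setminus V(B)])=I(Y_G):B .$$
   Context: Let $\mathbb{F}_q$ be a finite field, $\mathbb{K}=\overline{\mathbb{F}}_q$ an algebraic closure, and $X=X_\Sigma$ an $n$-dimensional simplicial complete toric variety over $\mathbb{K}$ with fan $\Sigma$ in $\mathbb{R}^n$, whose rays $\rho_1,\dots,\rho_r$ have primitive generators $\mathbf{v}_1,\dots,\mathbf{v}_r\in\mathbb{Z}^n$. Let $\phi$ be the $r\times n$ matrix with rows $\mathbf{v}_i$; it is assumed that there is a short exact sequence $0\to\mathbb{Z}^n\xrightarrow{\phi}\mathbb{Z}^r\xrightarrow{\beta}\mathbb{Z}^d\to0$ ($d=r-n$) with $\beta=[\beta_1\cdots\beta_r]$ a $d\times r$ matrix of rank $d$ with non-negative integer entries. Let $S=\mathbb{F}_q[x_1,\dots,x_r]$, $\mathbb{Z}^d$-graded by $\deg_\beta(x_j)=\beta_j$ (the graded pieces $S_\alpha$ are finite-dimensional); "homogeneous" refers to this grading. Let $L_\beta=\mathrm{Ker}(\beta)\subseteq\mathbb{Z}^r$ and $G=\{P\in(\mathbb{K}^* )^r:\mathbf{x}^{\mathbf{m}}(P)=1\text{ for all }\mathbf{m}\in L_\beta\}$, acting on $\mathbb{A}^r=\mathbb{K}^r$ by coordinatewise multiplication. $B=\langle\mathbf{x}^{\hat\sigma}=\prod_{\rho_i\not\subset\sigma}x_i:\sigma\in\Sigma\rangle\subset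 S$, where the product is over the rays $\rho_i$ that are not rays of $\sigma$, and $V(B)\subseteq\mathbb{K}^r$ is its zero set, which is $G$-invariant. For $Y\subseteq\mathbb{A}^r$, $Y_G=[Y]$ denotes the set of $G$-orbits $[P]=G\cdot P$ of points $P\in Y$; $\mathbb{A}^r_G=\mathbb{K}^r/G$ and $V_G(B)=[V(B)]$. For a set $Y_G$ of orbits, $I(Y_G)\subseteq S$ is the ideal generated by the homogeneous polynomials in $S$ vanishing at all $P\in Y$ (for homogeneous $F$, vanishing at $P$ depends only on $[P]$). For ideals, $J:B=\{F\in S:FF'\in J\text{ for all }F'\in B\}$. *)

theory Defs
  imports
    "HOL-Analysis.Analysis"
    "HOL-Algebra.Algebraic_Closure_Type"
    "HOL-Library.Poly_Mapping"
begin

unbundle no Formal_Power_Series.fps_syntax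

section \<open>Fans\<close>

definition real_vec :: "int ^ 'n \<Rightarrow> real ^ 'n" where
  "real_vec u = (\<chi> k. of_int (u $ k))"

definition rational_polyhedral_cone :: "(real ^ 'n) set \<Rightarrow> bool" where
  "rational_polyhedral_cone \<sigma> \<longleftrightarrow>
    (\<exists>A :: (int ^ 'n) set. finite A \<and> \<sigma> = convex_cone hull (real_vec ` A))"

definition strongly_convex :: "(real ^ 'n) set \<Rightarrow> bool" where
  "strongly_convex \<sigma> \<longleftrightarrow> \<sigma> \<inter> uminus ` \<sigma> = {0}"

text \<open>Faces are cut out by supporting hyperplanes through the origin; unlike for
  \<^const>\<open>face_of\<close>, the empty set is not a face of a cone.\<close>

definition cone_face :: "(real ^ 'n) set \<Rightarrow> (real ^ 'n) set \<Rightarrow> bool" where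
  "cone_face \<tau> \<sigma> \<longleftrightarrow> (\<exists>m. (\<forall>x\<in>\<sigma>. 0 \<le> m \<bullet> x) \<and> \<tau> = {x \<in> \<sigma>. m \<bullet> x = 0})"

definition fan :: "(real ^ 'n) set set \<Rightarrow> bool" where
  "fan \<Sigma> \<longleftrightarrow> finite \<Sigma> \<and>
    (\<forall>\<sigma>\<in>\<Sigma>. rational_polyhedral_cone \<sigma> \<and> strongly_convex \<sigma>) \<and>
    (\<forall>\<sigma>\<in>\<Sigma>. \<forall>\<tau>. cone_face \<tau> \<sigma> \<longrightarrow> \<tau> \<in> \<Sigma>) \<and>
    (\<forall>\<sigma>\<in>\<Sigma>. \<forall>\<sigma>'\<in>\<Sigma>. cone_face (\<sigma> \<inter> \<sigma>') \<sigma> \<and> cone_face (\<sigma> \<inter> \<sigma>') \<sigma>')"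

definition complete_fan :: "(real ^ 'n) set set \<Rightarrow> bool" where
  "complete_fan \<Sigma> \<longleftrightarrow> fan \<Sigma> \<and> \<Union>\<Sigma> = UNIV"

definition simplicial_fan :: "(real ^ 'n) set set \<Rightarrow> bool" where
  "simplicial_fan \<Sigma> \<longleftrightarrow> fan \<Sigma> \<and>
    (\<forall>\<sigma>\<in>\<Sigma>. \<exists>A. finite A \<and> independent A \<and> \<sigma> = convex_cone hull A)"

text \<open>The rows of the matrix \<open>\<phi>\<close> are the vectors \<open>v\<^sub>i\<close>.\<close>

definition ray :: "int ^ 'n ^ 'r \<Rightarrow> 'r \<Rightarrow> (real ^ 'n) set" where
  "ray \<phi> i = convex_cone hull {real_vec (\<phi> $ i)}"

definition primitive_ray_generators :: "(real ^ 'n) set set \<Rightarrow> int ^ 'n ^ 'r \<Rightarrow> bool" where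
  "primitive_ray_generators \<Sigma> \<phi> \<longleftrightarrow>
    bij_betw (ray \<phi>) UNIV {\<sigma> \<in> \<Sigma>. dim \<sigma> = 1} \<and>
    (\<forall>i. Gcd {\<phi> $ i $ k | k. True} = 1)"

text \<open>Exactness of \<open>0 \<rightarrow> \<int>\<^sup>n \<rightarrow> \<int>\<^sup>r \<rightarrow> \<int>\<^sup>d \<rightarrow> 0\<close> with maps \<open>\<phi>\<close> and \<open>\<beta>\<close>.\<close>

definition short_exact :: "int ^ 'n ^ 'r \<Rightarrow> int ^ 'r ^ 'd \<Rightarrow> bool" where
  "short_exact \<phi> \<beta> \<longleftrightarrow> inj ((*v) \<phi>) \<and> range ((*v) \<phi>) = {m. \<beta> *v m = 0} \<and> surj ((*v) \<beta>)"

section \<open>The graded polynomial ring\<close>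

text \<open>A polynomial in variables indexed by \<open>'r\<close> is a finitely supported function on exponent
  vectors \<open>'r \<Rightarrow>\<^sub>0 nat\<close>; multiplication is convolution.\<close>

type_synonym ('r, 'f) mpoly = "('r \<Rightarrow>\<^sub>0 nat) \<Rightarrow>\<^sub>0 'f"

definition monomial_degree :: "int ^ 'r ^ 'd \<Rightarrow> ('r::finite \<Rightarrow>\<^sub>0 nat) \<Rightarrow> int ^ 'd" where
  "monomial_degree \<beta> m = \<beta> *v (\<chi> j. int (Poly_Mapping.lookup m j))"

definition homogeneous :: "int ^ 'r ^ 'd \<Rightarrow> ('r::finite, 'f::zero) mpoly \<Rightarrow> bool" where
  "homogeneous \<beta> F \<longleftrightarrow> (\<exists>\<alpha>. \<forall>m \<in> Poly_Mapping.keys F. monomial_degree \<beta> m = \<alpha>)"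

definition monomial_value :: "('r::finite \<Rightarrow>\<^sub>0 nat) \<Rightarrow> 'k::comm_monoid_mult ^ 'r \<Rightarrow> 'k" where
  "monomial_value m P = (\<Prod>j\<in>UNIV. P $ j ^ Poly_Mapping.lookup m j)"

definition poly_value :: "('r::finite, 'f::field) mpoly \<Rightarrow> 'f alg_closure ^ 'r \<Rightarrow> 'f alg_closure"
  where "poly_value F P =
    (\<Sum>m \<in> Poly_Mapping.keys F. to_ac (Poly_Mapping.lookup F m) * monomial_value m P)"

text \<open>The ideal generated by a set: the submodule it spans in the ring as a module over itself.\<close>

definition ideal_generated :: "'a::comm_ring_1 set \<Rightarrow> 'a set" where
  "ideal_generated A = Modules.module.span (*) A"

definition ideal_quotient :: "'a::comm_ring_1 set \<Rightarrow> 'a set \<Rightarrow> 'a set" where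
  "ideal_quotient J B = {F. \<forall>F'\<in>B. F * F' \<in> J}"

definition zero_set :: "('r::finite, 'f::field) mpoly set \<Rightarrow> ('f alg_closure ^ 'r) set" where
  "zero_set B = {P. \<forall>F\<in>B. poly_value F P = 0}"

section \<open>The irrelevant ideal\<close>

definition cone_exponent :: "int ^ 'n ^ 'r \<Rightarrow> (real ^ 'n) set \<Rightarrow> ('r::finite \<Rightarrow>\<^sub>0 nat)" where
  "cone_exponent \<phi> \<sigma> = Abs_poly_mapping (\<lambda>i. if ray \<phi> i \<subseteq> \<sigma> then 0 else 1)"

definition irrelevant_ideal ::
    "(real ^ 'n) set set \<Rightarrow> int ^ 'n ^ 'r \<Rightarrow> ('r::finite, 'f::field) mpoly set" where
  "irrelevant_ideal \<Sigma> \<phi> =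
    ideal_generated {Poly_Mapping.single (cone_exponent \<phi> \<sigma>) 1 | \<sigma>. \<sigma> \<in> \<Sigma>}"

section \<open>Orbits and vanishing ideals\<close>

definition group_G :: "int ^ 'r ^ 'd \<Rightarrow> ('k::field ^ 'r) set" where
  "group_G \<beta> = {P. (\<forall>j. P $ j \<noteq> 0) \<and> (\<forall>m. \<beta> *v m = 0 \<longrightarrow> (\<Prod>j\<in>UNIV. P $ j powi (m $ j)) = 1)}"

definition orbit :: "int ^ 'r ^ 'd \<Rightarrow> 'k::field ^ 'r \<Rightarrow> ('k ^ 'r) set" where
  "orbit \<beta> P = {g * P | g. g \<in> group_G \<beta>}"

definition orbits :: "int ^ 'r ^ 'd \<Rightarrow> ('k::field ^ 'r) set \<Rightarrow> ('k ^ 'r) set set" where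
  "orbits \<beta> Y = orbit \<beta> ` Y"

definition vanishing_ideal ::
    "int ^ 'r ^ 'd \<Rightarrow> ('f::field alg_closure ^ 'r) set set \<Rightarrow> ('r::finite, 'f) mpoly set" where
  "vanishing_ideal \<beta> Q =
    ideal_generated {F. homogeneous \<beta> F \<and> (\<forall>P. orbit \<beta> P \<in> Q \<longrightarrow> poly_value F P = 0)}"

section \<open>Well-definedness on orbits\<close>

interpretation ring_module: Modules.module "(*) :: 'a::comm_ring_1 \<Rightarrow> 'a \<Rightarrow> 'a"
  rewrites "Modules.module.span (*) = (ideal_generated :: 'a set \<Rightarrow> 'a set)"
  by unfold_locales (auto simp: algebra_simps ideal_generated_def fun_eq_iff)

lemma monomial_value_add: "monomial_value (m + m') P = monomial_value m P * monomial_value m' P"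
  by (simp add: monomial_value_def lookup_add power_add prod.distrib)

lemma monomial_value_times: "monomial_value m (g * P) = monomial_value m g * monomial_value m P"
  by (simp add: monomial_value_def power_mult_distrib prod.distrib)

lemma monomial_value_group_nonzero:
  "g \<in> group_G \<beta> \<Longrightarrow> monomial_value m g \<noteq> 0"
  by (auto simp: group_G_def monomial_value_def)

lemma poly_value_superset:
  assumes "finite A" "Poly_Mapping.keys F \<subseteq> A"
  shows "poly_value F P = (\<Sum>m\<in>A. to_ac (Poly_Mapping.lookup F m) * monomial_value m P)"
  unfolding poly_value_def
  using assms by (intro sum.mono_neutral_left) (auto simp: in_keys_iff)

lemma poly_value_add: "poly_value (F + G) P = poly_value F P + poly_value G P"
proof -
  let ?A = "Poly_Mapping.keys F \<union> Poly_Mapping.keys G"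
  have "Poly_Mapping.keys (F + G) \<subseteq> ?A" by (rule keys_add)
  then show ?thesis
    by (simp add: poly_value_superset[of ?A] lookup_add algebra_simps sum.distrib)
qed

lemma poly_value_0 [simp]: "poly_value 0 P = 0"
  by (simp add: poly_value_def)

lemma poly_value_sum: "poly_value (sum F A) P = (\<Sum>a\<in>A. poly_value (F a) P)"
  by (induction A rule: infinite_finite_induct) (simp_all add: poly_value_add)

lemma poly_value_single: "poly_value (Poly_Mapping.single m c) P = to_ac c * monomial_value m P"
  by (subst poly_value_superset[of "{m}"]) auto

lemma poly_sum_singles:
  "F = (\<Sum>m\<in>Poly_Mapping.keys F. Poly_Mapping.single m (Poly_Mapping.lookup F m))"
  by (rule poly_mapping_eqI)
    (auto simp: lookup_sum lookup_single when_def not_in_keys_iff_lookup_eq_zero)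

lemma poly_value_mult: "poly_value (F * G) P = poly_value F P * poly_value G P"
proof -
  let ?mon = "\<lambda>H m. Poly_Mapping.single m (Poly_Mapping.lookup H m)"
  have "F * G = (\<Sum>m\<in>Poly_Mapping.keys F. ?mon F m) * (\<Sum>m\<in>Poly_Mapping.keys G. ?mon G m)"
    using poly_sum_singles[of F] poly_sum_singles[of G] by metis
  also have "\<dots> = (\<Sum>m\<in>Poly_Mapping.keys F. \<Sum>m'\<in>Poly_Mapping.keys G. ?mon F m * ?mon G m')"
    by (rule sum_product)
  finally have FG: "F * G = \<dots>" .
  have "poly_value (F * G) P = (\<Sum>m\<in>Poly_Mapping.keys F. \<Sum>m'\<in>Poly_Mapping.keys G.
      poly_value (?mon F m * ?mon G m') P)"
    by (simp only: FG poly_value_sum)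
  also have "\<dots> = (\<Sum>m\<in>Poly_Mapping.keys F. \<Sum>m'\<in>Poly_Mapping.keys G.
      (to_ac (Poly_Mapping.lookup F m) * monomial_value m P) *
      (to_ac (Poly_Mapping.lookup G m') * monomial_value m' P))"
    by (intro sum.cong refl)
      (simp only: mult_single poly_value_single monomial_value_add to_ac_mult, simp only: ac_simps)
  also have "\<dots> = poly_value F P * poly_value G P"
    by (simp only: poly_value_def sum_product)
  finally show ?thesis .
qed

lemma zero_set_ideal_generated:
  "zero_set (ideal_generated A) = (zero_set A :: ('f::field alg_closure ^ 'r::finite) set)"
proof
  show "zero_set (ideal_generated A) \<subseteq> zero_set A"
    unfolding zero_set_def using ring_module.span_superset[of A] by auto
  show "zero_set A \<subseteq> zero_set (ideal_generated A)"
  proof (clarsimp simp: zero_set_def)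
    fix P :: "'f alg_closure ^ 'r" and F :: "('r, 'f) mpoly"
    assume A: "\<forall>F\<in>A. poly_value F P = 0" and F: "F \<in> ideal_generated A"
    from F show "poly_value F P = 0"
      by (induction rule: ring_module.span_induct_alt)
        (use A in \<open>auto simp: poly_value_add poly_value_mult\<close>)
  qed
qed

lemma zero_set_irrelevant_ideal:
  "zero_set (irrelevant_ideal \<Sigma> \<phi>)
    = {P. \<forall>\<sigma>\<in>\<Sigma>. monomial_value (cone_exponent \<phi> \<sigma>) P = 0}"
  unfolding irrelevant_ideal_def zero_set_ideal_generated
  by (auto simp: zero_set_def poly_value_single)

lemma zero_set_irrelevant_ideal_invariant:
  assumes "g \<in> group_G \<beta>"
  shows "g * P \<in> zero_set (irrelevant_ideal \<Sigma> \<phi>) \<longleftrightarrow> P \<in> zero_set (irrelevant_ideal \<Sigma> \<phi>)"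
  using monomial_value_group_nonzero[OF assms]
  by (simp add: zero_set_irrelevant_ideal monomial_value_times)

lemma one_in_group_G: "(\<chi> j. 1) \<in> group_G \<beta>"
  by (simp add: group_G_def)

lemma orbit_self: "P \<in> orbit \<beta> P"
  unfolding orbit_def using one_in_group_G[of \<beta>]
  by (auto intro!: exI[of _ "\<chi> j. 1"] simp: vec_eq_iff)

lemma orbits_diff_zero_set:
  "orbits \<beta> (Y - zero_set (irrelevant_ideal \<Sigma> \<phi>))
    \<subseteq> orbits \<beta> UNIV - orbits \<beta> (zero_set (irrelevant_ideal \<Sigma> \<phi>))"
proof -
  have "P \<in> zero_set (irrelevant_ideal \<Sigma> \<phi>)"
    if "orbit \<beta> P = orbit \<beta> Q" "Q \<in> zero_set (irrelevant_ideal \<Sigma> \<phi>)" for P Q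
  proof -
    have "P \<in> orbit \<beta> Q" using that(1) orbit_self[of P \<beta>] by simp
    then obtain g where "g \<in> group_G \<beta>" "P = g * Q" by (auto simp: orbit_def)
    then show ?thesis using that(2) by (simp add: zero_set_irrelevant_ideal_invariant)
  qed
  then show ?thesis by (auto simp: orbits_def)
qed

lemma monomial_value_group_eq:
  assumes g: "g \<in> group_G \<beta>" and eq: "monomial_degree \<beta> m = monomial_degree \<beta> m'"
  shows "monomial_value m g = monomial_value m' g"
proof -
  define u where "u = (\<chi> j. int (Poly_Mapping.lookup m j) - int (Poly_Mapping.lookup m' j))"
  have "u = (\<chi> j. int (Poly_Mapping.lookup m j)) - (\<chi> j. int (Poly_Mapping.lookup m' j))"
    by (simp add: u_def vec_eq_iff)
  then have "\<beta> *v u = 0"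
    using eq by (simp add: monomial_degree_def matrix_vector_mult_diff_distrib)
  then have "(\<Prod>j\<in>UNIV. g $ j powi (u $ j)) = 1"
    using g by (simp add: group_G_def)
  moreover have "g $ j \<noteq> 0" for j using g by (simp add: group_G_def)
  ultimately have "monomial_value m g / monomial_value m' g = 1"
    by (simp add: u_def power_int_diff prod_dividef monomial_value_def)
  then show ?thesis by auto
qed

lemma homogeneous_vanishing_invariant:
  assumes F: "homogeneous \<beta> F" and g: "g \<in> group_G \<beta>"
  shows "poly_value F (g * P) = 0 \<longleftrightarrow> poly_value F P = 0"
proof (cases "F = 0")
  case False
  then obtain m where m: "m \<in> Poly_Mapping.keys F" by fastforce
  define c where "c = monomial_value m g"
  have "monomial_value m' g = c" if "m' \<in> Poly_Mapping.keys F" for m'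
    using F g m that unfolding c_def by (metis homogeneous_def monomial_value_group_eq)
  then have "poly_value F (g * P) =
      (\<Sum>m\<in>Poly_Mapping.keys F. c * (to_ac (Poly_Mapping.lookup F m) * monomial_value m P))"
    unfolding poly_value_def
    by (intro sum.cong refl) (simp only: monomial_value_times mult.left_commute)
  then have "poly_value F (g * P) = c * poly_value F P"
    by (simp only: poly_value_def sum_distrib_left)
  then show ?thesis using monomial_value_group_nonzero[OF g] by (simp add: c_def)
qed simp

lemma vanishing_ideal_orbits:
  "vanishing_ideal \<beta> (orbits \<beta> Y)
    = ideal_generated {F. homogeneous \<beta> F \<and> (\<forall>P\<in>Y. poly_value F P = 0)}"
proof -
  have "poly_value F P = 0"
    if "homogeneous \<beta> F" "\<forall>P\<in>Y. poly_value F P = 0" "orbit \<beta> P \<in> orbits \<beta> Y" for F P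
  proof -
    from that(3) obtain Q where Q: "Q \<in> Y" "orbit \<beta> P = orbit \<beta> Q"
      by (auto simp: orbits_def)
    then obtain g where "g \<in> group_G \<beta>" "P = g * Q"
      using orbit_self[of P \<beta>] by (auto simp: orbit_def)
    then show ?thesis using that(1,2) Q homogeneous_vanishing_invariant by blast
  qed
  then have "{F. homogeneous \<beta> F \<and> (\<forall>P. orbit \<beta> P \<in> orbits \<beta> Y \<longrightarrow> poly_value F P = 0)}
      = {F. homogeneous \<beta> F \<and> (\<forall>P\<in>Y. poly_value F P = 0)}"
    by (auto simp: orbits_def)
  then show ?thesis by (simp add: vanishing_ideal_def)
qed

end

theory Submission
  imports Defs
begin

text \<open>The ideal generated by the homogeneous polynomials vanishing on \<open>Y\<close> consists of the polynomials
  all of whose graded components vanish on \<open>Y\<close>. Multiplying by a monomial only shifts the components,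
  so the ideal quotient can be computed componentwise: if \<open>F g\<close> lies in the ideal for every
  generator \<open>g\<close> of \<open>B\<close>, every component of \<open>F\<close> vanishes on \<open>Y\<close> wherever some \<open>g\<close> does not.\<close>

definition component :: "int ^ 'r ^ 'd \<Rightarrow> int ^ 'd \<Rightarrow> ('r::finite, 'f::zero) mpoly \<Rightarrow> ('r, 'f) mpoly"
  where "component \<beta> \<alpha> F =
    Abs_poly_mapping (\<lambda>m. Poly_Mapping.lookup F m when monomial_degree \<beta> m = \<alpha>)"

lemma lookup_component:
  "Poly_Mapping.lookup (component \<beta> \<alpha> F) m = (Poly_Mapping.lookup F m when monomial_degree \<beta> m = \<alpha>)"
proof -
  have "finite {m. (Poly_Mapping.lookup F m when monomial_degree \<beta> m = \<alpha>) \<noteq> 0}"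
    by (rule finite_subset[OF _ finite_keys[of F]]) (auto simp: in_keys_iff)
  then show ?thesis
    unfolding component_def by (simp add: lookup_Abs_poly_mapping)
qed

lemma component_add: "component \<beta> \<alpha> (F + G) = component \<beta> \<alpha> F + component \<beta> \<alpha> G"
  by (rule poly_mapping_eqI) (simp add: lookup_component lookup_add when_def)

lemma component_0 [simp]: "component \<beta> \<alpha> 0 = 0"
  by (rule poly_mapping_eqI) (simp add: lookup_component)

lemma component_sum: "component \<beta> \<alpha> (sum F A) = (\<Sum>a\<in>A. component \<beta> \<alpha> (F a))"
  by (induction A rule: infinite_finite_induct) (simp_all add: component_add)

lemma component_single:
  "component \<beta> \<alpha> (Poly_Mapping.single m c)
    = (if monomial_degree \<beta> m = \<alpha> then Poly_Mapping.single m c else 0)"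
  by (rule poly_mapping_eqI) (auto simp: lookup_component lookup_single when_def)

lemma keys_component:
  "Poly_Mapping.keys (component \<beta> \<alpha> F) = {m \<in> Poly_Mapping.keys F. monomial_degree \<beta> m = \<alpha>}"
  by (auto simp: in_keys_iff lookup_component)

lemma homogeneous_component: "homogeneous \<beta> (component \<beta> \<alpha> F)"
  by (auto simp: homogeneous_def keys_component)

text \<open>Only finitely many degrees occur among the monomials of \<open>F\<close>, and each
  monomial lies in exactly one component, so the sum is finite and recovers
  \<open>F\<close>.\<close>

lemma sum_components:
  "(\<Sum>\<alpha> \<in> monomial_degree \<beta> ` Poly_Mapping.keys F. component \<beta> \<alpha> F) = F"
  by (rule poly_mapping_eqI) (auto simp: lookup_sum lookup_component when_def in_keys_iff sum.delta)

lemma component_of_homogeneous: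
  assumes "homogeneous \<beta> F"
  shows "component \<beta> \<alpha> F = F \<or> component \<beta> \<alpha> F = 0"
proof -
  from assms obtain \<gamma> where \<gamma>: "monomial_degree \<beta> m = \<gamma>" if "m \<in> Poly_Mapping.keys F" for m
    by (auto simp: homogeneous_def)
  show ?thesis
  proof (cases "\<alpha> = \<gamma>")
    case True
    then have "component \<beta> \<alpha> F = F"
      using \<gamma> by (intro poly_mapping_eqI) (auto simp: lookup_component when_def in_keys_iff)
    then show ?thesis ..
  next
    case False
    then have "component \<beta> \<alpha> F = 0"
      using \<gamma> by (intro poly_mapping_eqI) (auto simp: lookup_component when_def in_keys_iff)
    then show ?thesis ..
  qed
qed

lemma monomial_degree_add:
  "monomial_degree \<beta> (m + m') = monomial_degree \<beta> m + monomial_degree \<beta> m'"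
proof -
  have "(\<chi> j. int (Poly_Mapping.lookup (m + m') j))
      = (\<chi> j. int (Poly_Mapping.lookup m j)) + (\<chi> j. int (Poly_Mapping.lookup m' j))"
    by (simp add: vec_eq_iff lookup_add)
  then show ?thesis
    by (simp add: monomial_degree_def matrix_vector_right_distrib)
qed

text \<open>Both sides are additive in \<open>F\<close>, so it suffices to compare them on single
  monomials, where degrees add. Degrees live in the group \<open>int ^ 'd\<close>, so the shift
  makes sense even when no monomial of \<open>F\<close> has the shifted degree.\<close>

lemma component_mult_single:
  fixes F :: "('r::finite, 'f::comm_ring_1) mpoly"
  shows "component \<beta> \<alpha> (F * Poly_Mapping.single m c)
    = component \<beta> (\<alpha> - monomial_degree \<beta> m) F * Poly_Mapping.single m c"
proof -
  let ?mon = "\<lambda>m. Poly_Mapping.single m (Poly_Mapping.lookup F m)"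
  have *: "component \<beta> \<alpha> (?mon m' * Poly_Mapping.single m c)
      = component \<beta> (\<alpha> - monomial_degree \<beta> m) (?mon m') * Poly_Mapping.single m c" for m'
    by (auto simp: mult_single component_single monomial_degree_add)
  have "component \<beta> \<alpha> ((\<Sum>m\<in>Poly_Mapping.keys F. ?mon m) * Poly_Mapping.single m c)
      = component \<beta> (\<alpha> - monomial_degree \<beta> m) (\<Sum>m\<in>Poly_Mapping.keys F. ?mon m)
        * Poly_Mapping.single m c"
    by (simp only: sum_distrib_right component_sum *)
  then show ?thesis
    by (simp only: poly_sum_singles[symmetric])
qed

text \<open>Polynomials whose components all vanish on \<open>Y\<close> form an ideal containing the
  generators. Conversely, the components of such a polynomial are themselves generators, and they
  sum to it.\<close>

lemma vanishing_ideal_iff_components: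
  "F \<in> vanishing_ideal \<beta> (orbits \<beta> Y) \<longleftrightarrow> (\<forall>\<alpha>. \<forall>P\<in>Y. poly_value (component \<beta> \<alpha> F) P = 0)"
proof
  let ?A = "{F. homogeneous \<beta> F \<and> (\<forall>P\<in>Y. poly_value F P = 0)}"
  assume "F \<in> vanishing_ideal \<beta> (orbits \<beta> Y)"
  then have "F \<in> ideal_generated ?A"
    by (simp add: vanishing_ideal_orbits)
  then show "\<forall>\<alpha>. \<forall>P\<in>Y. poly_value (component \<beta> \<alpha> F) P = 0"
  proof (induction rule: ring_module.span_induct_alt)
    case base
    show ?case by simp
  next
    case (step c x y)
    \<comment> \<open>A generator is homogeneous, so each of its components is itself or zero. The
      claim is needed for every degree, since the next step applies it at a shifted one.\<close>
    have "poly_value (component \<beta> \<alpha> x) P = 0" if "P \<in> Y" for \<alpha> P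
      using component_of_homogeneous[of \<beta> x \<alpha>] step(1) that by auto
    then have "poly_value (component \<beta> \<alpha> (x * Poly_Mapping.single m a)) P = 0"
      if "P \<in> Y" for \<alpha> P m a
      using that by (simp add: component_mult_single poly_value_mult)
    \<comment> \<open>The multiplier \<open>c\<close> need not be homogeneous, so it is expanded
      into monomials, each of which only shifts degrees.\<close>
    then have "poly_value (component \<beta> \<alpha> (x *
        (\<Sum>m\<in>Poly_Mapping.keys c. Poly_Mapping.single m (Poly_Mapping.lookup c m)))) P = 0"
      if "P \<in> Y" for \<alpha> P
      using that by (simp add: sum_distrib_left component_sum poly_value_sum)
    then have "poly_value (component \<beta> \<alpha> (x * c)) P = 0" if "P \<in> Y" for \<alpha> P
      using that by (simp only: poly_sum_singles[symmetric])
    then show ?case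
      using step(2) by (simp add: component_add poly_value_add mult.commute[of c])
  qed
next
  assume "\<forall>\<alpha>. \<forall>P\<in>Y. poly_value (component \<beta> \<alpha> F) P = 0"
  then have "(\<Sum>\<alpha> \<in> monomial_degree \<beta> ` Poly_Mapping.keys F. component \<beta> \<alpha> F)
      \<in> vanishing_ideal \<beta> (orbits \<beta> Y)"
    unfolding vanishing_ideal_orbits
    by (intro ring_module.span_sum ring_module.span_base) (simp add: homogeneous_component)
  then show "F \<in> vanishing_ideal \<beta> (orbits \<beta> Y)"
    by (simp add: sum_components)
qed

text \<open>For fixed \<open>F\<close>, the \<open>G\<close> with \<open>F * G\<close> in
  \<open>J\<close> form an ideal, so testing generators suffices.\<close>

lemma ideal_quotient_ideal_generated:
  assumes "ring_module.subspace J"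
  shows "F \<in> ideal_quotient J (ideal_generated A) \<longleftrightarrow> (\<forall>G\<in>A. F * G \<in> J)"
proof
  assume "F \<in> ideal_quotient J (ideal_generated A)"
  then show "\<forall>G\<in>A. F * G \<in> J"
    by (simp add: ideal_quotient_def ring_module.span_base)
next
  assume A: "\<forall>G\<in>A. F * G \<in> J"
  have "F * G \<in> J" if "G \<in> ideal_generated A" for G
    using that
  proof (induction rule: ring_module.span_induct_alt)
    case base
    show ?case using ring_module.subspace_0[OF assms] by (simp only: mult_zero_right)
  next
    case (step c x y)
    have "c * (F * x) + F * y \<in> J"
      using A step
      by (intro ring_module.subspace_add[OF assms ring_module.subspace_scale[OF assms]]) auto
    then show ?case by (simp only: distrib_left mult.left_commute)
  qed
  then show "F \<in> ideal_quotient J (ideal_generated A)"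
    by (simp add: ideal_quotient_def)
qed

theorem theorem4p1:
  fixes \<Sigma> :: "(real ^ 'n) set set"
    and \<phi> :: "int ^ 'n ^ 'r"
    and \<beta> :: "int ^ 'r ^ 'd"
    and Y :: "('f::{field,finite} alg_closure ^ 'r) set"
  assumes "complete_fan \<Sigma>"
    and "simplicial_fan \<Sigma>"
    and "primitive_ray_generators \<Sigma> \<phi>"
    and "short_exact \<phi> \<beta>"
    and "CARD('r) = CARD('n) + CARD('d)"
    and "rank (map_matrix rat_of_int \<beta>) = CARD('d)"
    and "\<forall>i j. 0 \<le> \<beta> $ i $ j"
  shows "vanishing_ideal \<beta> (orbits \<beta> (Y - zero_set (irrelevant_ideal \<Sigma> \<phi>)))
    = ideal_quotient (vanishing_ideal \<beta> (orbits \<beta> Y)) (irrelevant_ideal \<Sigma> \<phi>)"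
proof (rule Set.set_eqI)
  fix F :: "('r, 'f) mpoly"
  let ?x = "\<lambda>\<sigma>. Poly_Mapping.single (cone_exponent \<phi> \<sigma>) (1::'f)"
  let ?J = "vanishing_ideal \<beta> (orbits \<beta> Y)"
  have "F \<in> ideal_quotient ?J (irrelevant_ideal \<Sigma> \<phi>) \<longleftrightarrow> (\<forall>\<sigma>\<in>\<Sigma>. F * ?x \<sigma> \<in> ?J)"
    unfolding irrelevant_ideal_def
    by (subst ideal_quotient_ideal_generated) (auto simp: vanishing_ideal_def)
  \<comment> \<open>Values lie in a field, so a component of \<open>F * ?x \<sigma>\<close> vanishes
    at \<open>P\<close> exactly when the shifted component of \<open>F\<close> or the monomial
    does.\<close>
  also have "\<dots> \<longleftrightarrow> (\<forall>\<sigma>\<in>\<Sigma>. \<forall>\<alpha>. \<forall>P\<in>Y. poly_value (component \<beta> \<alpha> F) P = 0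
      \<or> monomial_value (cone_exponent \<phi> \<sigma>) P = 0)"
  proof -
    \<comment> \<open>Translation by \<gamma> permutes the degrees, so the shift disappears once all
      degrees are quantified over.\<close>
    have "(\<forall>\<alpha>. Q (\<alpha> - \<gamma>)) \<longleftrightarrow> (\<forall>\<alpha>. Q \<alpha>)" for Q and \<gamma> :: "int ^ 'd"
      by (metis add_diff_cancel_right')
    from this[of "\<lambda>\<alpha>. \<forall>P\<in>Y. poly_value (component \<beta> \<alpha> F) P = 0
        \<or> monomial_value (cone_exponent \<phi> \<sigma>) P = 0"
        "monomial_degree \<beta> (cone_exponent \<phi> \<sigma>)" for \<sigma>]
    show ?thesis
      by (simp only: vanishing_ideal_iff_components component_mult_single poly_value_mult
          poly_value_single mult_eq_0_iff to_ac_1 mult_1)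
  qed
  \<comment> \<open>A point lies outside \<open>V(B)\<close> exactly when some cone monomial is
    nonzero there. Exchanging quantifiers turns the condition into the component criterion for
    \<open>Y\<close> without \<open>V(B)\<close>.\<close>
  also have "\<dots> \<longleftrightarrow> F \<in> vanishing_ideal \<beta> (orbits \<beta> (Y - zero_set (irrelevant_ideal \<Sigma> \<phi>)))"
    by (auto simp: vanishing_ideal_iff_components zero_set_irrelevant_ideal)
  finally show "F \<in> vanishing_ideal \<beta> (orbits \<beta> (Y - zero_set (irrelevant_ideal \<Sigma> \<phi>)))
      \<longleftrightarrow> F \<in> ideal_quotient ?J (irrelevant_ideal \<Sigma> \<phi>)"
    by blast
qed

end
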